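(* For all positive integers $n,m$, the second player does not win the Peaceable Kings Game $\mathrm{PK}(n,m)$; that is, the first player has a winning strategy.
   Context: The Peaceable Kings Game $\mathrm{PK}(n,m)$ is played on an $n\times m$ chessboard with squares $(x,y)$, $0\leq x\leq n-1$, $0\leq y\leq m-1$. Two players alternately place a king on an unoccupied square; the first player places white kings and the second player places black kings. A player may not place a king on a square within attacking range of a king previously placed by the opponent. A player unable to move on their turn loses. Two distinct squares $(x_1,y_1)$ and $(x_2,y_2)$ are within attacking range for kings iff $|x_1-x_2|\leq 1$ and $|y_1-y_2|\leq 1$. A player "wins" the game if that player has a winning strategy. *)

theory Defs
  imports Main
begin

type_synonym square = "int \<times> int"

datatype player = First | Second

fun opponent :: "player \<Rightarrow> player" where
  "opponent First = Second"
| "opponent Second = First"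

definition board :: "nat \<Rightarrow> nat \<Rightarrow> square set" where
  "board n m = {(x, y). 0 \<le> x \<and> x \<le> int n - 1 \<and> 0 \<le> y \<and> y \<le> int m - 1}"

definition king_attacks :: "square \<Rightarrow> square \<Rightarrow> bool" where
  "king_attacks s t \<longleftrightarrow>
     s \<noteq> t \<and> \<bar>fst s - fst t\<bar> \<le> 1 \<and> \<bar>snd s - snd t\<bar> \<le> 1"

text \<open>A play (or partial play) is recorded as the list of squares chosen so far, oldest
  first; the moves at even indices are the white kings of the first player, those at odd
  indices the black kings of the second player. There is no passing.\<close>

definition turn :: "nat \<Rightarrow> player" where
  "turn k = (if even k then First else Second)"

definition kings :: "player \<Rightarrow> square list \<Rightarrow> square set" where
  "kings p h = {h ! i | i. i < length h \<and> turn i = p}"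

definition legal_move :: "nat \<Rightarrow> nat \<Rightarrow> square list \<Rightarrow> square \<Rightarrow> bool" where
  "legal_move n m h s \<longleftrightarrow>
     s \<in> board n m \<and> s \<notin> set h \<and>
     (\<forall>t \<in> kings (opponent (turn (length h))) h. \<not> king_attacks t s)"

definition legal_play :: "nat \<Rightarrow> nat \<Rightarrow> square list \<Rightarrow> bool" where
  "legal_play n m h \<longleftrightarrow> (\<forall>i < length h. legal_move n m (take i h) (h ! i))"

text \<open>A strategy may depend on the whole play so far.\<close>

type_synonym strategy = "square list \<Rightarrow> square"

definition follows :: "player \<Rightarrow> strategy \<Rightarrow> square list \<Rightarrow> bool" where
  "follows p \<sigma> h \<longleftrightarrow> (\<forall>i < length h. turn i = p \<longrightarrow> h ! i = \<sigma> (take i h))"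

text \<open>A winning strategy proposes a legal move whenever its owner has one, and in every
  completed play that follows it the player who is unable to move is the opponent. Only
  finite plays have to be considered, by lemma \<open>legal_play_length\<close> below.\<close>

definition winning_strategy :: "nat \<Rightarrow> nat \<Rightarrow> player \<Rightarrow> strategy \<Rightarrow> bool" where
  "winning_strategy n m p \<sigma> \<longleftrightarrow>
     (\<forall>h. legal_play n m h \<and> follows p \<sigma> h \<and> turn (length h) = p
            \<and> (\<exists>s. legal_move n m h s) \<longrightarrow> legal_move n m h (\<sigma> h)) \<and>
     (\<forall>h. legal_play n m h \<and> follows p \<sigma> h \<and> \<not> (\<exists>s. legal_move n m h s)
            \<longrightarrow> turn (length h) = opponent p)"

definition wins_PK :: "nat \<Rightarrow> nat \<Rightarrow> player \<Rightarrow> bool" where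
  "wins_PK n m p \<longleftrightarrow> (\<exists>\<sigma>. winning_strategy n m p \<sigma>)"

lemma board_eq: "board n m = {0..int n - 1} \<times> {0..int m - 1}"
  by (auto simp: board_def)

lemma legal_play_length:
  assumes "legal_play n m h"
  shows "length h \<le> n * m"
proof -
  have new: "h ! i \<in> board n m \<and> h ! i \<notin> set (take i h)" if "i < length h" for i
    using assms that by (simp add: legal_play_def legal_move_def)
  have lt: "h ! i \<noteq> h ! j" if "i < j" "j < length h" for i j
  proof -
    have "h ! i \<in> set (take j h)"
      using that by (auto simp: in_set_conv_nth intro!: exI[of _ i])
    then show ?thesis using new[OF that(2)] by metis
  qed
  have "distinct h"
    unfolding distinct_conv_nth using lt by (metis linorder_neqE_nat)
  then have "length h = card (set h)"
    by (simp add: distinct_card)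
  also have "\<dots> \<le> card (board n m)"
  proof (rule card_mono)
    show "finite (board n m)" by (simp add: board_eq)
    show "set h \<subseteq> board n m" using new by (metis in_set_conv_nth subsetI)
  qed
  also have "\<dots> = n * m"
    by (simp add: board_eq card_cartesian_product)
  finally show ?thesis .
qed

end

theory Submission
  imports Defs
begin

text \<open>White opens on a central square and then answers every black king by its image under
  the point reflection of the board. A square attacks or equals its reflection only if it is
  central, and the opening king keeps Black away from all central squares. Hence the reply is
  always legal: anything obstructing it would, reflected, have obstructed Black's move.\<close>

definition mirror :: "nat \<Rightarrow> nat \<Rightarrow> square \<Rightarrow> square" where
  "mirror n m s = (int n - 1 - fst s, int m - 1 - snd s)"

text \<open>A side of even length has two middle coordinates; \<open>div\<close> picks the lower
  one.\<close>

definition centre :: "nat \<Rightarrow> nat \<Rightarrow> square" where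
  "centre n m = ((int n - 1) div 2, (int m - 1) div 2)"

definition mirror_strategy :: "nat \<Rightarrow> nat \<Rightarrow> strategy" where
  "mirror_strategy n m h = (if h = [] then centre n m else mirror n m (last h))"

lemma mirror_mirror [simp]: "mirror n m (mirror n m s) = s"
  by (simp add: mirror_def)

lemma mirror_in_board_iff [simp]: "mirror n m s \<in> board n m \<longleftrightarrow> s \<in> board n m"
  by (auto simp: mirror_def board_def split: prod.splits)

lemma king_attacks_mirror [simp]:
  "king_attacks (mirror n m s) (mirror n m t) \<longleftrightarrow> king_attacks s t"
  by (auto simp: king_attacks_def mirror_def prod_eq_iff abs_minus_commute)

lemma centre_in_board: "n \<ge> 1 \<Longrightarrow> m \<ge> 1 \<Longrightarrow> centre n m \<in> board n m"
  by (auto simp: centre_def board_def)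

lemma eq_or_king_attacks_iff:
  "s = t \<or> king_attacks s t \<longleftrightarrow> \<bar>fst s - fst t\<bar> \<le> 1 \<and> \<bar>snd s - snd t\<bar> \<le> 1"
  by (auto simp: king_attacks_def)

text \<open>In each coordinate, with \<open>a\<close> the largest coordinate,
  \<open>a - 2 * (a div 2)\<close> is the parity of \<open>a\<close>, so 0 or 1. This keeps Black
  off the reflection of the opening king, whose own mirror square is already taken.\<close>

lemma mirror_centre_near:
  "centre n m = mirror n m (centre n m) \<or> king_attacks (centre n m) (mirror n m (centre n m))"
proof -
  have "\<bar>a div 2 - (a - a div 2)\<bar> \<le> 1" for a :: int by linarith
  then show ?thesis
    unfolding eq_or_king_attacks_iff mirror_def centre_def fst_conv snd_conv by blast
qed

text \<open>In each coordinate, \<open>2 * x\<close> within 1 of \<open>a\<close> forces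
  \<open>x\<close> to be \<open>a div 2\<close> or \<open>a div 2 + 1\<close>.\<close>

lemma near_mirror_imp_near_centre:
  assumes "s = mirror n m s \<or> king_attacks s (mirror n m s)"
  shows "centre n m = s \<or> king_attacks (centre n m) s"
proof -
  have "\<bar>a div 2 - x\<bar> \<le> 1" if "\<bar>x - (a - x)\<bar> \<le> 1" for a x :: int using that by linarith
  then show ?thesis
    using assms unfolding eq_or_king_attacks_iff mirror_def centre_def fst_conv snd_conv by blast
qed

lemma legal_play_snoc:
  "legal_play n m (h @ [s]) \<longleftrightarrow> legal_play n m h \<and> legal_move n m h s"
  by (auto simp: legal_play_def nth_append less_Suc_eq)

lemma follows_snoc:
  "follows p \<sigma> (h @ [s]) \<longleftrightarrow> follows p \<sigma> h \<and> (turn (length h) = p \<longrightarrow> s = \<sigma> h)"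
  by (auto simp: follows_def nth_append less_Suc_eq)

lemma legal_play_distinct:
  assumes "legal_play n m h" "i < length h" "j < i"
  shows "h ! i \<noteq> h ! j"
proof -
  have "h ! i \<notin> set (take i h)"
    using assms by (simp add: legal_play_def legal_move_def)
  moreover have "h ! j \<in> set (take i h)"
    using assms by (auto simp: in_set_conv_nth intro!: exI[of _ j])
  ultimately show ?thesis by metis
qed

lemma legal_play_not_attacks:
  assumes "legal_play n m h" "i < length h" "j < i" "turn j = opponent (turn i)"
  shows "\<not> king_attacks (h ! j) (h ! i)"
proof -
  have "legal_move n m (take i h) (h ! i)"
    using assms by (simp add: legal_play_def)
  moreover have "h ! j \<in> kings (opponent (turn i)) (take i h)"
    using assms by (auto simp: kings_def intro!: exI[of _ j])
  ultimately show ?thesis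
    using assms(2) by (simp add: legal_move_def min_def)
qed

lemma legal_move_mirror_strategy:
  assumes "n \<ge> 1" "m \<ge> 1" and leg: "legal_play n m h"
    and fol: "follows First (mirror_strategy n m) h" and ev: "even (length h)"
  shows "legal_move n m h (mirror_strategy n m h)"
proof (cases "h = []")
  case True
  then show ?thesis
    using centre_in_board[OF assms(1,2)]
    by (simp add: legal_move_def mirror_strategy_def kings_def)
next
  case False
  \<comment> \<open>\<open>k\<close> is the index of Black's latest king \<open>s\<close>, the one
    White has to answer.\<close>
  define k where "k = length h - 1"
  have k: "length h = Suc k" "odd k" "k > 0"
    using False ev by (cases h; auto simp: k_def elim: oddE)+
  define s where "s = h ! k"
  have reply: "mirror_strategy n m h = mirror n m s"
    using False by (simp add: mirror_strategy_def s_def k_def last_conv_nth)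
  have h0: "h ! 0 = centre n m"
    using fol k by (simp add: follows_def turn_def mirror_strategy_def)
  \<comment> \<open>White's answer to the king at an odd index \<open>j\<close> stands at
    \<open>Suc j\<close>; \<open>j = k\<close> is excluded because that answer is still to
    come.\<close>
  have pair: "h ! Suc j = mirror n m (h ! j)" if "odd j" "j < k" for j
  proof -
    have "h ! Suc j = mirror_strategy n m (take (Suc j) h)"
      using fol that k by (simp add: follows_def turn_def)
    then show ?thesis
      using that k by (simp add: mirror_strategy_def take_Suc_conv_app_nth)
  qed
  have fresh: "s \<noteq> h ! j" if "j < k" for j
    using legal_play_distinct[OF leg _ that] k by (simp add: s_def)
  have safe: "\<not> king_attacks (h ! j) s" if "j < k" "even j" for j
    using legal_play_not_attacks[OF leg _ that(1)] that k by (simp add: s_def turn_def)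
  have away: "s \<noteq> centre n m" "\<not> king_attacks (centre n m) s"
    using fresh[of 0] safe[of 0] k h0 by auto
  have away': "s \<noteq> mirror n m s" "\<not> king_attacks s (mirror n m s)"
    using near_mirror_imp_near_centre away by blast+
  have "s \<in> board n m"
    using leg k by (simp add: legal_play_def legal_move_def s_def)
  moreover have "h ! j \<noteq> mirror n m s" if "j \<le> k" for j
  proof
    assume eq: "h ! j = mirror n m s"
    then have s: "s = mirror n m (h ! j)" by simp
    \<comment> \<open>The four cases are the opening king, \<open>s\<close> itself, an earlier black
      king, and White's answer to one.\<close>
    have "j = 0 \<or> j = k \<or> odd j \<and> j < k \<or> (\<exists>i. j = Suc i \<and> odd i \<and> i < k)"
      using that by (cases j) auto
    then consider "j = 0" | "j = k" | "odd j" "j < k" | i where "j = Suc i" "odd i" "i < k"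
      by blast
    then show False
    proof cases
      case 1
      then show ?thesis
        using s h0 mirror_centre_near[of n m] away by auto
    next
      case 2
      then show ?thesis using eq away' by (simp add: s_def)
    next
      case 3
      \<comment> \<open>Both \<open>j\<close> and \<open>k\<close> are odd, so \<open>Suc j\<close>
        cannot equal \<open>k\<close>, and \<open>fresh\<close> applies to it.\<close>
      then have "Suc j < k" using k by presburger
      then show ?thesis using pair[OF 3] s fresh by metis
    next
      case 4
      then show ?thesis using pair[of i] s fresh[of i] by simp
    qed
  qed
  moreover have "\<not> king_attacks (h ! j) (mirror n m s)" if "j \<le> k" "odd j" for j
  proof (cases "j = k")
    case True
    then show ?thesis using away' by (simp add: s_def)
  next
    case False
    \<comment> \<open>An earlier black king attacking the reply would, reflected, be a white king
      attacking \<open>s\<close>.\<close>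
    then have "Suc j < k" using that k by presburger
    then have "\<not> king_attacks (mirror n m (h ! j)) s"
      using pair[of j] safe[of "Suc j"] that by simp
    then show ?thesis
      by (metis king_attacks_mirror mirror_mirror)
  qed
  ultimately show ?thesis
    using k unfolding reply legal_move_def
    by (auto simp: kings_def turn_def in_set_conv_nth less_Suc_eq_le split: if_splits)
qed

text \<open>The reply is legal at every turn of White, so a play that follows the strategy can only
  get stuck with Black to move.\<close>

lemma winning_mirror_strategy:
  assumes "n \<ge> 1" "m \<ge> 1"
  shows "winning_strategy n m First (mirror_strategy n m)"
  using legal_move_mirror_strategy[OF assms]
  unfolding winning_strategy_def turn_def by fastforce

text \<open>Played against each other, two winning strategies would produce a finished play lost by
  both sides.\<close>

lemma not_both_win:
  assumes "wins_PK n m First"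
  shows "\<not> wins_PK n m Second"
proof
  assume "wins_PK n m Second"
  with assms obtain \<sigma> \<tau>
    where win: "winning_strategy n m First \<sigma>" "winning_strategy n m Second \<tau>"
    by (auto simp: wins_PK_def)
  define P where "P h \<longleftrightarrow> legal_play n m h \<and> follows First \<sigma> h \<and> follows Second \<tau> h" for h
  have "P []" by (simp add: P_def legal_play_def follows_def)
  moreover have "\<forall>h. P h \<longrightarrow> length h < Suc (n * m)"
    using legal_play_length by (simp add: P_def less_Suc_eq_le)
  \<comment> \<open>The number of squares bounds the length of a play, so some play following both
    strategies is longest.\<close>
  ultimately obtain h where h: "P h" and longest: "\<And>g. P g \<Longrightarrow> length g \<le> length h"
    using ex_has_greatest_nat[of P "[]" length "Suc (n * m)"] by blast
  show False
  proof (cases "\<exists>s. legal_move n m h s")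
    case True
    define s where "s = (if turn (length h) = First then \<sigma> h else \<tau> h)"
    have "legal_move n m h s"
      using win h True by (cases "turn (length h)") (auto simp: winning_strategy_def P_def s_def)
    then have "P (h @ [s])"
      using h by (auto simp: P_def legal_play_snoc follows_snoc s_def)
    then show False using longest by fastforce
  next
    case False
    \<comment> \<open>Each strategy guarantees that the other player is the one to move in a stuck
      position.\<close>
    then have "turn (length h) = opponent First" "turn (length h) = opponent Second"
      using win h unfolding winning_strategy_def P_def by blast+
    then show False by simp
  qed
qed

theorem theorem5p1:
  fixes n m :: nat
  assumes "n \<ge> 1" and "m \<ge> 1"
  shows "\<not> wins_PK n m Second \<and> wins_PK n m First"
proof -
  have "wins_PK n m First"
    using winning_mirror_strategy[OF assms] by (auto simp: wins_PK_def)
  then show ?thesis using not_both_win by blast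
qed

end
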